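(* Let $q$ be a prime power, let $X^n=(X_1,\dots,X_n)$ be i.i.d. and uniform on $\mathbb{F}_q$, and let $\mathbf{H}$ be an $(n-k)\times n$ parity check matrix of an $(n,k,d)$ MDS code over $\mathbb{F}_q$, with $1\le k\le n$. Then the syndrome list-source code that encodes $X^n$ as its syndrome $S^{n-k}=\mathbf{H}X^n$ has absolute symbol secrecy $$\mu_0=L,\qquad\text{where } L=\frac{k}{n},$$ i.e. it attains the upper bound $L$ on absolute symbol secrecy.
   Context: An $(n,k,d)$ linear code over $\mathbb{F}_q$ has length $n$, dimension $k$ and minimum distance $d$; it is MDS if $d=n-k+1$. A parity check matrix $\mathbf{H}$ satisfies $\mathbf{c}\in\mathcal{C}\Leftrightarrow\mathbf{H}\mathbf{c}=0$. Syndrome list-source code (no source coding is applied, since the source is uniform): the encoder computes $S^{n-k}=\mathbf{H}X^n\in\mathbb{F}_q^{n-k}$ and maps each syndrome to a distinct binary codeword $Y$. The decoder recovers $S^{n-k}$ from $Y$ and outputs as its list the coset $\{x\in\mathbb{F}_q^n:\mathbf{H}x=S^{n-k}\}$. This list has size $q^k=|\mathbb{F}_q|^{nL}$ with $L=k/n$, so $L$ is the normalized list size. Let $\mathcal{I}_n(t)$ be the set of all $t$-element subsets of $\{1,\dots,n\}$, and for $\mathcal{J}\subseteq\{1,\dots,n\}$ let $X^{(\mathcal{J})}=(X_i)_{i\in\mathcal{J}}$. The absolute symbol secrecy of the code is $$\mu_0=\max\left\{\frac{t}{n}:\ I(X^{(\mathcal{J})};Y)=0\ \ \forall\,\mathcal{J}\in\mathcal{I}_n(t)\right\},$$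 where $t$ ranges over $\{0,1,\dots,n\}$ and $I$ denotes mutual information. *)

theory Defs
  imports "HOL-Probability.Probability" "Jordan_Normal_Form.VS_Connect"
begin

text \<open>The alphabet is a finite field \<^typ>\<open>'a\<close>; for every prime power q there is such a field,
  with \<open>q = CARD('a)\<close>, unique up to isomorphism. Coordinates are numbered
  \<open>0, \<dots>, n - 1\<close>, as in the vector library.\<close>

definition hamming_dist :: "'a vec \<Rightarrow> 'a vec \<Rightarrow> nat" where
  "hamming_dist x y = card {i. i < dim_vec x \<and> x $ i \<noteq> y $ i}"

text \<open>Only meaningful for codes with at least two codewords.\<close>

definition min_dist :: "'a vec set \<Rightarrow> nat" where
  "min_dist C = Min {hamming_dist x y | x y. x \<in> C \<and> y \<in> C \<and> x \<noteq> y}"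

definition linear_code :: "nat \<Rightarrow> nat \<Rightarrow> nat \<Rightarrow> 'a::{finite, field} vec set \<Rightarrow> bool" where
  "linear_code n k d C \<longleftrightarrow>
     VectorSpace.subspace class_ring C (module_vec TYPE('a) n) \<and>
     vectorspace.dim class_ring ((module_vec TYPE('a) n)\<lparr>carrier := C\<rparr>) = k \<and>
     min_dist C = d"

definition mds_code :: "nat \<Rightarrow> nat \<Rightarrow> nat \<Rightarrow> 'a::{finite, field} vec set \<Rightarrow> bool" where
  "mds_code n k d C \<longleftrightarrow> linear_code n k d C \<and> d = n - k + 1"

definition parity_check_matrix :: "'a::{finite, field} mat \<Rightarrow> 'a vec set \<Rightarrow> bool" where
  "parity_check_matrix H C \<longleftrightarrow>
     C \<subseteq> carrier_vec (dim_col H) \<and>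
     (\<forall>c \<in> carrier_vec (dim_col H). c \<in> C \<longleftrightarrow> H *\<^sub>v c = 0\<^sub>v (dim_row H))"

definition uniform_iid :: "'w measure \<Rightarrow> nat \<Rightarrow> (nat \<Rightarrow> 'w \<Rightarrow> 'a::finite) \<Rightarrow> bool" where
  "uniform_iid M n X \<longleftrightarrow>
     prob_space.indep_vars M (\<lambda>_. count_space UNIV) X {..<n} \<and>
     (\<forall>i<n. distr M (count_space UNIV) (X i) = uniform_count_measure UNIV)"

definition source_vec :: "nat \<Rightarrow> (nat \<Rightarrow> 'w \<Rightarrow> 'a) \<Rightarrow> 'w \<Rightarrow> 'a vec" where
  "source_vec n X \<omega> = vec n (\<lambda>i. X i \<omega>)"

definition subvector :: "nat set \<Rightarrow> (nat \<Rightarrow> 'w \<Rightarrow> 'a) \<Rightarrow> 'w \<Rightarrow> (nat \<Rightarrow> 'a)" where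
  "subvector J X \<omega> = restrict (\<lambda>i. X i \<omega>) J"

text \<open>A lossless list-source code with encoder \<open>f\<close> and list decoder \<open>g\<close>: the list contains the
  source word and has size \<open>q\<^sup>n\<^sup>L\<close>, so \<open>L\<close> is the normalized list size.\<close>

definition list_source_code ::
  "nat \<Rightarrow> real \<Rightarrow> ('a::finite vec \<Rightarrow> 'y) \<Rightarrow> ('y \<Rightarrow> 'a vec set) \<Rightarrow> bool" where
  "list_source_code n L f g \<longleftrightarrow>
     (\<forall>x \<in> carrier_vec n. g (f x) \<subseteq> carrier_vec n \<and> x \<in> g (f x) \<and>
        real (card (g (f x))) = real CARD('a) powr (real n * L))"

text \<open>The map \<open>enc\<close> assigns a binary codeword to each syndrome; it is assumed to be injective
  on syndromes wherever these notions are used.\<close>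

definition syndrome_encoder ::
  "'a::{finite, field} mat \<Rightarrow> ('a vec \<Rightarrow> bool list) \<Rightarrow> 'a vec \<Rightarrow> bool list" where
  "syndrome_encoder H enc x = enc (H *\<^sub>v x)"

definition syndrome_decoder ::
  "'a::{finite, field} mat \<Rightarrow> ('a vec \<Rightarrow> bool list) \<Rightarrow> bool list \<Rightarrow> 'a vec set" where
  "syndrome_decoder H enc y =
     {x \<in> carrier_vec (dim_col H). H *\<^sub>v x = the_inv_into (carrier_vec (dim_row H)) enc y}"

text \<open>Mutual information is measured in bits. The set is never empty: \<open>t = 0\<close> always qualifies.\<close>

definition absolute_symbol_secrecy ::
  "'w measure \<Rightarrow> nat \<Rightarrow> (nat \<Rightarrow> 'w \<Rightarrow> 'a) \<Rightarrow> ('w \<Rightarrow> 'y) \<Rightarrow> real" where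
  "absolute_symbol_secrecy M n X Y =
     Max {real t / real n | t. t \<le> n \<and>
       (\<forall>J. J \<subseteq> {..<n} \<and> card J = t \<longrightarrow>
          information_space.mutual_information_Pow M 2 (subvector J X) Y = 0)}"

end

theory Submission
  imports Defs
begin

text \<open>For a set J of at least k coordinates, the pair of \<open>X\<close> restricted to J and the syndrome
  determines \<open>X\<close>: two words with equal syndrome that agree on J differ by a codeword of weight
  at most \<open>n - k < d\<close>. So every attained value of the pair has probability \<open>q\<^sup>-\<^sup>n\<close>. The marginals
  are uniform with probabilities \<open>q\<^sup>-\<^sup>|\<^sup>J\<^sup>|\<close> and \<open>q\<^sup>k\<^sup>-\<^sup>n\<close>, the latter because each coset of the code
  has \<open>q\<^sup>k\<close> elements. Hence the mutual information is exactly \<open>(|J| - k) log q\<close>, which vanishes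
  for \<open>|J| = k\<close> and is positive for \<open>|J| > k\<close>.\<close>

section \<open>Finite vector spaces and the size of a linear code\<close>

lemma (in vectorspace) card_carrier_eq_power_dim:
  assumes "fin_dim"
  shows "card (carrier V) = card (carrier K) ^ dim"
proof -
  obtain A where A: "finite A" "basis A"
    using finite_basis_exists[OF assms] by blast
  have AV: "A \<subseteq> carrier V"
    using A(2) by (simp add: basis_def)
  \<comment> \<open>Extensional functions stand for coordinate tuples with respect to the basis:
    each vector has exactly one, so counting vectors becomes counting functions.\<close>
  have unique: "\<exists>!a. a \<in> A \<rightarrow>\<^sub>E carrier K \<and> lincomb a A = v" if "v \<in> carrier V" for v
    using basis_criterion[OF A(1) AV] A(2) that by blast
  have closed: "lincomb a A \<in> carrier V" if "a \<in> A \<rightarrow>\<^sub>E carrier K" for a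
    using that AV by (intro lincomb_closed) auto
  have "bij_betw (\<lambda>a. lincomb a A) (A \<rightarrow>\<^sub>E carrier K) (carrier V)"
    unfolding bij_betw_def inj_on_def
  proof (intro conjI ballI impI equalityI subsetI)
    fix a b assume "a \<in> A \<rightarrow>\<^sub>E carrier K" "b \<in> A \<rightarrow>\<^sub>E carrier K" "lincomb a A = lincomb b A"
    then show "a = b"
      using unique[OF closed[of b]] by blast
  next
    fix v assume "v \<in> carrier V"
    then show "v \<in> (\<lambda>a. lincomb a A) ` (A \<rightarrow>\<^sub>E carrier K)"
      using unique by blast
  qed (use closed in auto)
  then have "card (carrier V) = card (A \<rightarrow>\<^sub>E carrier K)"
    using bij_betw_same_card by metis
  also have "\<dots> = card (carrier K) ^ card A"
    using A(1) by (simp add: card_PiE)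
  finally show ?thesis
    using dim_basis[OF A] by simp
qed

lemma finite_carrier_vec: "finite (carrier_vec n :: 'a::finite vec set)"
proof -
  have "carrier_vec n \<subseteq> vec_of_list ` {xs :: 'a list. set xs \<subseteq> UNIV \<and> length xs = n}"
  proof
    fix v :: "'a vec" assume "v \<in> carrier_vec n"
    then show "v \<in> vec_of_list ` {xs. set xs \<subseteq> UNIV \<and> length xs = n}"
      by (intro image_eqI[of _ _ "list_of_vec v"]) (auto simp: vec_list)
  qed
  moreover have "finite (vec_of_list ` {xs :: 'a list. set xs \<subseteq> UNIV \<and> length xs = n})"
    by (intro finite_imageI finite_lists_length_eq) simp
  ultimately show ?thesis
    by (rule finite_subset)
qed

lemma card_linear_code:
  fixes C :: "'a::{finite, field} vec set"
  assumes "linear_code n k d C"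
  shows "card C = CARD('a) ^ k"
proof -
  interpret vec_space "TYPE('a)" n .
  have sub: "VectorSpace.subspace class_ring C V"
    and dim: "vectorspace.dim class_ring (vs C) = k"
    using assms by (simp_all add: linear_code_def)
  interpret W: vectorspace class_ring "vs C"
    by (rule subspace_is_vs[OF sub])
  have "C \<subseteq> carrier_vec n"
    using sub by (auto simp: VectorSpace.subspace_def submodule_def)
  then have "finite C"
    using finite_carrier_vec finite_subset by blast
  \<comment> \<open>The finite set \<open>C\<close> generates itself, so it witnesses finite
    dimension.\<close>
  moreover have "W.gen_set C"
    using W.in_own_span[of C] W.span_is_subset2[of C] by auto
  ultimately have "W.fin_dim"
    by (auto simp: W.fin_dim_def)
  from W.card_carrier_eq_power_dim[OF this] dim show ?thesis
    by simp
qed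

section \<open>Minimum distance, cosets and the decoding list\<close>

lemma min_dist_le_hamming_dist:
  fixes C :: "'a::finite vec set"
  assumes "C \<subseteq> carrier_vec n" "x \<in> C" "y \<in> C" "x \<noteq> y"
  shows "min_dist C \<le> hamming_dist x y"
  unfolding min_dist_def
proof (rule Min_le)
  \<comment> \<open>\<open>Min\<close> is a lower bound only on a finite set, so the set of
    distances must be shown finite.\<close>
  have "finite C"
    using assms(1) finite_carrier_vec finite_subset by blast
  then have "finite ((\<lambda>(x, y). hamming_dist x y) ` (C \<times> C))"
    by simp
  then show "finite {hamming_dist x y |x y. x \<in> C \<and> y \<in> C \<and> x \<noteq> y}"
    by (rule finite_subset[rotated]) auto
qed (use assms in blast)

text \<open>Translation by \<open>x\<close> carries the code, which is the kernel of
  \<open>H\<close>, bijectively onto the words that share the syndrome of \<open>x\<close>.\<close>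

lemma card_syndrome_fiber:
  fixes H :: "'a::{finite, field} mat"
  assumes H: "H \<in> carrier_mat m n" and C: "parity_check_matrix H C"
    and x: "x \<in> carrier_vec n"
  shows "card {y \<in> carrier_vec n. H *\<^sub>v y = H *\<^sub>v x} = card C"
proof -
  have Cn: "C \<subseteq> carrier_vec n" and C_iff: "\<And>c. c \<in> carrier_vec n \<Longrightarrow> c \<in> C \<longleftrightarrow> H *\<^sub>v c = 0\<^sub>v m"
    using H C by (auto simp: parity_check_matrix_def)
  have "bij_betw (\<lambda>c. c + x) C {y \<in> carrier_vec n. H *\<^sub>v y = H *\<^sub>v x}"
  proof (rule bij_betw_byWitness[where f' = "\<lambda>y. y - x"])
    show "\<forall>c\<in>C. c + x - x = c"
      by (intro ballI eq_vecI) (use Cn x in auto)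
    show "\<forall>y\<in>{y \<in> carrier_vec n. H *\<^sub>v y = H *\<^sub>v x}. y - x + x = y"
      using x by auto
    show "(\<lambda>c. c + x) ` C \<subseteq> {y \<in> carrier_vec n. H *\<^sub>v y = H *\<^sub>v x}"
    proof safe
      fix c assume "c \<in> C"
      then have c: "c \<in> carrier_vec n" "H *\<^sub>v c = 0\<^sub>v m"
        using Cn C_iff by auto
      then show "c + x \<in> carrier_vec n" "H *\<^sub>v (c + x) = H *\<^sub>v x"
        using mult_add_distrib_mat_vec[OF H c(1) x] mult_mat_vec_carrier[OF H x] x by auto
    qed
    show "(\<lambda>y. y - x) ` {y \<in> carrier_vec n. H *\<^sub>v y = H *\<^sub>v x} \<subseteq> C"
    proof safe
      fix y assume y: "y \<in> carrier_vec n" "H *\<^sub>v y = H *\<^sub>v x"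
      then show "y - x \<in> C"
        using C_iff[of "y - x"] mult_minus_distrib_mat_vec[OF H y(1) x]
          mult_mat_vec_carrier[OF H x] x by auto
    qed
  qed
  then show ?thesis
    using bij_betw_same_card by metis
qed

lemma eq_if_syndrome_eq_and_agree:
  fixes H :: "'a::{finite, field} mat" and x y :: "'a vec"
  assumes H: "H \<in> carrier_mat m n" and C: "parity_check_matrix H C"
    and mds: "mds_code n k d C" and J: "J \<subseteq> {..<n}" "k \<le> card J"
    and xy: "x \<in> carrier_vec n" "y \<in> carrier_vec n"
    and syn: "H *\<^sub>v x = H *\<^sub>v y" and agree: "\<And>i. i \<in> J \<Longrightarrow> x $ i = y $ i"
  shows "x = y"
proof (rule ccontr)
  assume "x \<noteq> y"
  have Cn: "C \<subseteq> carrier_vec n" and C_iff: "\<And>c. c \<in> carrier_vec n \<Longrightarrow> c \<in> C \<longleftrightarrow> H *\<^sub>v c = 0\<^sub>v m"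
    using H C by (auto simp: parity_check_matrix_def)
  have "H *\<^sub>v (0\<^sub>v n) = 0\<^sub>v m"
    using H by auto
  then have zero: "0\<^sub>v n \<in> C"
    using C_iff by simp
  have diff: "x - y \<in> C"
    using C_iff[of "x - y"] mult_minus_distrib_mat_vec[OF H xy] mult_mat_vec_carrier[OF H xy(2)]
      syn xy by auto
  have "x - y \<noteq> 0\<^sub>v n"
    using \<open>x \<noteq> y\<close> xy by (auto simp: vec_eq_iff)
  \<comment> \<open>The distance to the zero codeword is the weight of \<open>x - y\<close>, whose
    support avoids \<open>J\<close>.\<close>
  then have "min_dist C \<le> hamming_dist (x - y) (0\<^sub>v n)"
    using min_dist_le_hamming_dist[OF Cn diff zero] by simp
  also have "\<dots> \<le> card ({..<n} - J)"
    unfolding hamming_dist_def using xy agree by (intro card_mono) auto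
  also have "\<dots> = n - card J"
    using J(1) by (subst card_Diff_subset) (auto intro: finite_subset)
  also have "\<dots> < n - k + 1"
    using J(2) by simp
  finally show False
    using mds by (simp add: mds_code_def linear_code_def)
qed

text \<open>Every syndrome lies in the set on which \<open>enc\<close> is injective, so
  \<open>the_inv_into\<close> recovers it and the list is the full coset of the source word, of the
  same size as the code.\<close>

lemma list_source_code_syndrome:
  fixes H :: "'a::{finite, field} mat"
  assumes H: "H \<in> carrier_mat m n" and C: "parity_check_matrix H C"
    and card_C: "card C = CARD('a) ^ k" and "n > 0"
    and enc: "inj_on enc (carrier_vec m)"
  shows "list_source_code n (real k / real n) (syndrome_encoder H enc) (syndrome_decoder H enc)"
  unfolding list_source_code_def
proof
  fix x :: "'a vec" assume x: "x \<in> carrier_vec n"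
  have "the_inv_into (carrier_vec m) enc (enc (H *\<^sub>v x)) = H *\<^sub>v x"
    using the_inv_into_f_f[OF enc] mult_mat_vec_carrier[OF H x] by simp
  then have dec: "syndrome_decoder H enc (syndrome_encoder H enc x)
      = {y \<in> carrier_vec n. H *\<^sub>v y = H *\<^sub>v x}"
    using H by (auto simp: syndrome_decoder_def syndrome_encoder_def)
  have "real (CARD('a) ^ k) = real CARD('a) powr (real n * (real k / real n))"
    using \<open>n > 0\<close> by (simp add: powr_realpow)
  then show "syndrome_decoder H enc (syndrome_encoder H enc x) \<subseteq> carrier_vec n \<and>
      x \<in> syndrome_decoder H enc (syndrome_encoder H enc x) \<and>
      real (card (syndrome_decoder H enc (syndrome_encoder H enc x)))
        = real CARD('a) powr (real n * (real k / real n))"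
    unfolding dec card_syndrome_fiber[OF H C x] card_C using x by auto
qed

section \<open>Distribution of the uniform source\<close>

context prob_space
begin

lemma uniform_iid_measurable:
  assumes "uniform_iid M n X" "i < n"
  shows "X i \<in> measurable M (count_space UNIV)"
  using assms by (auto simp: uniform_iid_def indep_vars_def)

lemma uniform_iid_prob_single:
  fixes X :: "nat \<Rightarrow> 'a \<Rightarrow> 'b::finite"
  assumes unif: "uniform_iid M n X" and "i < n"
  shows "prob (X i -` {a} \<inter> space M) = 1 / real CARD('b)"
proof -
  have "prob (X i -` {a} \<inter> space M) = measure (distr M (count_space UNIV) (X i)) {a}"
    using uniform_iid_measurable[OF assms] by (simp add: measure_distr)
  also have "\<dots> = 1 / real CARD('b)"
    using assms by (simp add: uniform_iid_def measure_uniform_count_measure)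
  finally show ?thesis .
qed

lemma uniform_iid_prob:
  fixes X :: "nat \<Rightarrow> 'a \<Rightarrow> 'b::finite"
  assumes unif: "uniform_iid M n X" and J: "J \<subseteq> {..<n}"
  shows "prob {\<omega> \<in> space M. \<forall>i\<in>J. X i \<omega> = a i} = 1 / real CARD('b) ^ card J"
\<comment> \<open>The product rule for independent variables requires a nonempty index set, and an
  empty intersection would be \<open>UNIV\<close> instead of \<open>space M\<close>.\<close>
proof (cases "J = {}")
  case True
  then show ?thesis
    by (simp add: prob_space)
next
  case False
  have "finite J"
    using J finite_subset by blast
  have "{\<omega> \<in> space M. \<forall>i\<in>J. X i \<omega> = a i} = (\<Inter>i\<in>J. X i -` {a i} \<inter> space M)"
    using False by auto
  also have "prob \<dots> = (\<Prod>i\<in>J. prob (X i -` {a i} \<inter> space M))"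
    using unif J False \<open>finite J\<close> by (intro indep_varsD[where I = "{..<n}"]) (auto simp: uniform_iid_def)
  also have "\<dots> = (\<Prod>i\<in>J. 1 / real CARD('b))"
    using J uniform_iid_prob_single[OF unif] by (intro prod.cong) auto
  finally show ?thesis
    by (simp add: power_one_over)
qed

lemma source_vec_vimage:
  assumes "x \<in> carrier_vec n"
  shows "source_vec n X -` {x} \<inter> space M = {\<omega> \<in> space M. \<forall>i\<in>{..<n}. X i \<omega> = x $ i}"
  using assms by (auto simp: source_vec_def vec_eq_iff)

text \<open>The subvectors and the encoder output are functions of the source vector, so they
  inherit simplicity from it by composition.\<close>

lemma simple_function_source_vec:
  fixes X :: "nat \<Rightarrow> 'a \<Rightarrow> 'b::finite"
  assumes unif: "uniform_iid M n X"
  shows "simple_function M (source_vec n X)"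
  unfolding simple_function_def
proof (intro conjI ballI)
  have "source_vec n X ` space M \<subseteq> carrier_vec n"
    by (auto simp: source_vec_def)
  then show "finite (source_vec n X ` space M)"
    using finite_carrier_vec finite_subset by blast
  fix x assume "x \<in> source_vec n X ` space M"
  then have x: "x \<in> carrier_vec n"
    by (auto simp: source_vec_def)
  have "{\<omega> \<in> space M. \<forall>i\<in>{..<n}. X i \<omega> = x $ i} \<in> sets M"
  proof (rule sets.sets_Collect_finite_All)
    fix i assume "i \<in> {..<n}"
    then have "X i -` {x $ i} \<inter> space M \<in> sets M"
      using uniform_iid_measurable[OF unif] by (auto intro: measurable_sets)
    then show "{\<omega> \<in> space M. X i \<omega> = x $ i} \<in> sets M"
      by (simp add: vimage_def Int_def conj_commute)
  qed simp
  then show "source_vec n X -` {x} \<inter> space M \<in> sets M"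
    by (simp add: source_vec_vimage[OF x])
qed

text \<open>The event is a disjoint union over the words of \<open>A\<close>, all of equal
  probability. Taking a coset for \<open>A\<close> gives the law of the syndrome; taking a singleton
  gives the joint law.\<close>

lemma uniform_iid_prob_source_vec:
  fixes X :: "nat \<Rightarrow> 'a \<Rightarrow> 'b::finite"
  assumes unif: "uniform_iid M n X" and A: "A \<subseteq> carrier_vec n"
  shows "prob {\<omega> \<in> space M. source_vec n X \<omega> \<in> A} = real (card A) / real CARD('b) ^ n"
proof -
  have fin: "finite A"
    using A finite_carrier_vec finite_subset by blast
  have "{\<omega> \<in> space M. source_vec n X \<omega> \<in> A} = (\<Union>x\<in>A. source_vec n X -` {x} \<inter> space M)"
    by auto
  also have "prob \<dots> = (\<Sum>x\<in>A. prob (source_vec n X -` {x} \<inter> space M))"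
    using fin simple_functionD(2)[OF simple_function_source_vec[OF unif]]
    by (intro finite_measure_finite_Union) (auto simp: disjoint_family_on_def)
  also have "\<dots> = (\<Sum>x\<in>A. 1 / real CARD('b) ^ n)"
  proof (rule sum.cong[OF refl])
    fix x assume "x \<in> A"
    then have x: "x \<in> carrier_vec n"
      using A by auto
    show "prob (source_vec n X -` {x} \<inter> space M) = 1 / real CARD('b) ^ n"
      unfolding source_vec_vimage[OF x] using uniform_iid_prob[OF unif, of "{..<n}" "\<lambda>i. x $ i"]
      by simp
  qed
  finally show ?thesis
    by simp
qed

end

section \<open>Mutual information of a subvector and the syndrome\<close>

lemma mutual_information_subvector_syndrome:
  fixes X :: "nat \<Rightarrow> 'w \<Rightarrow> 'a::{finite, field}"
  assumes "prob_space M" and unif: "uniform_iid M n X"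
    and H: "H \<in> carrier_mat m n" and C: "parity_check_matrix H C"
    and mds: "mds_code n k d C" and enc: "inj_on enc (carrier_vec m)"
    and J: "J \<subseteq> {..<n}" "k \<le> card J"
  shows "information_space.mutual_information_Pow M 2 (subvector J X)
    (\<lambda>\<omega>. syndrome_encoder H enc (source_vec n X \<omega>)) = real (card J - k) * log 2 (real CARD('a))"
proof -
  interpret information_space M 2
    using \<open>prob_space M\<close> by (simp add: information_space_def information_space_axioms_def)
  let ?q = "real CARD('a)"
  let ?Z = "source_vec n X"
  let ?Y = "\<lambda>\<omega>. syndrome_encoder H enc (?Z \<omega>)"
  let ?XY = "\<lambda>\<omega>. (subvector J X \<omega>, ?Y \<omega>)"
  have q: "?q > 1"
  proof -
    have "card {0, 1 :: 'a} \<le> CARD('a)"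
      by (intro card_mono) auto
    then show ?thesis by simp
  qed
  have Z: "simple_function M ?Z"
    by (rule simple_function_source_vec[OF unif])
  have Zn: "?Z \<omega> \<in> carrier_vec n" for \<omega>
    by (simp add: source_vec_def)
  \<comment> \<open>This uses that \<open>J\<close> stays below \<open>n\<close>, where the vector
    entries are the source symbols.\<close>
  have subvector: "subvector J X = (\<lambda>x :: 'a vec. restrict (\<lambda>i. x $ i) J) \<circ> ?Z"
    using J(1) by (fastforce simp: subvector_def source_vec_def)
  have simple_X: "simple_function M (subvector J X)"
    unfolding subvector by (rule simple_function_compose[OF Z])
  have simple_Y: "simple_function M ?Y"
    using simple_function_compose[OF Z, of "syndrome_encoder H enc"] by (simp add: comp_def)
  have enc_eq: "syndrome_encoder H enc x = syndrome_encoder H enc y \<longleftrightarrow> H *\<^sub>v x = H *\<^sub>v y"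
    if "x \<in> carrier_vec n" "y \<in> carrier_vec n" for x y
    using that inj_on_eq_iff[OF enc] mult_mat_vec_carrier[OF H] by (simp add: syndrome_encoder_def)
  \<comment> \<open>\<open>simple_distributed\<close> fixes the mass function only at attained
    values, so all three laws can be given by constants.\<close>
  have X_dist: "simple_distributed M (subvector J X) (\<lambda>_. 1 / ?q ^ card J)"
  proof (rule simple_distributedI[OF simple_X])
    fix a assume "a \<in> subvector J X ` space M"
    \<comment> \<open>An attained \<open>a\<close> is \<open>undefined\<close> outside
      \<open>J\<close>, so equality with it is decided by the coordinates in
      \<open>J\<close>.\<close>
    then have "subvector J X -` {a} \<inter> space M = {\<omega> \<in> space M. \<forall>i\<in>J. X i \<omega> = a i}"
      by (auto simp: subvector_def fun_eq_iff) metis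
    then show "1 / ?q ^ card J = prob (subvector J X -` {a} \<inter> space M)"
      using uniform_iid_prob[OF unif J(1)] by simp
  qed simp
  have Y_dist: "simple_distributed M ?Y (\<lambda>_. ?q ^ k / ?q ^ n)"
  proof (rule simple_distributedI[OF simple_Y])
    fix y assume "y \<in> ?Y ` space M"
    then obtain \<omega>\<^sub>0 where y: "y = ?Y \<omega>\<^sub>0"
      by blast
    let ?A = "{x \<in> carrier_vec n. H *\<^sub>v x = H *\<^sub>v ?Z \<omega>\<^sub>0}"
    have "?Y -` {y} \<inter> space M = {\<omega> \<in> space M. ?Z \<omega> \<in> ?A}"
      using enc_eq Zn by (auto simp: y)
    moreover have "card ?A = CARD('a) ^ k"
      using card_syndrome_fiber[OF H C Zn] card_linear_code mds by (metis mds_code_def)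
    ultimately show "?q ^ k / ?q ^ n = prob (?Y -` {y} \<inter> space M)"
      using uniform_iid_prob_source_vec[OF unif, of ?A] by auto
  qed simp
  have XY_dist: "simple_distributed M ?XY (\<lambda>_. 1 / ?q ^ n)"
  proof (rule simple_distributedI[OF simple_function_Pair[OF simple_X simple_Y]])
    fix z assume "z \<in> ?XY ` space M"
    then obtain \<omega>\<^sub>0 where z: "z = ?XY \<omega>\<^sub>0"
      by blast
    \<comment> \<open>The minimum distance enters here: an observed pair pins down the source word,
      so it carries the mass of a single word.\<close>
    have "?Z \<omega> = ?Z \<omega>\<^sub>0" if "?XY \<omega> = ?XY \<omega>\<^sub>0" for \<omega>
    proof (rule eq_if_syndrome_eq_and_agree[OF H C mds J Zn Zn])
      show "H *\<^sub>v ?Z \<omega> = H *\<^sub>v ?Z \<omega>\<^sub>0"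
        using that enc_eq Zn by simp
      show "?Z \<omega> $ i = ?Z \<omega>\<^sub>0 $ i" if "i \<in> J" for i
        using \<open>?XY \<omega> = ?XY \<omega>\<^sub>0\<close> that by (metis subvector comp_apply prod.inject restrict_apply')
    qed
    moreover have "?XY \<omega> = ?XY \<omega>\<^sub>0" if "?Z \<omega> = ?Z \<omega>\<^sub>0" for \<omega>
      using that by (simp add: subvector)
    ultimately have "?XY -` {z} \<inter> space M = {\<omega> \<in> space M. ?Z \<omega> \<in> {?Z \<omega>\<^sub>0}}"
      unfolding z by blast
    then show "1 / ?q ^ n = prob (?XY -` {z} \<inter> space M)"
      using uniform_iid_prob_source_vec[OF unif, of "{?Z \<omega>\<^sub>0}"] Zn by simp
  qed simp
  \<comment> \<open>The ratio of the joint mass to the product of the marginals is the same for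
    every attained pair. Its logarithm therefore factors out of the sum, and the joint masses left
    over add up to 1.\<close>
  have "1 / ?q ^ n / (1 / ?q ^ card J * (?q ^ k / ?q ^ n)) = ?q ^ (card J - k)"
    using q J(2) by (simp add: power_diff)
  then have log: "log 2 (1 / ?q ^ n / (1 / ?q ^ card J * (?q ^ k / ?q ^ n)))
      = real (card J - k) * log 2 ?q"
    using q by (simp add: log_nat_power)
  have "mutual_information_Pow (subvector J X) ?Y
      = (\<Sum>(x, y)\<in>?XY ` space M. 1 / ?q ^ n * (real (card J - k) * log 2 ?q))"
    unfolding mutual_information_simple_distributed[OF X_dist Y_dist XY_dist] log ..
  also have "\<dots> = (\<Sum>z\<in>?XY ` space M. 1 / ?q ^ n) * (real (card J - k) * log 2 ?q)"
    by simp
  also have "\<dots> = real (card J - k) * log 2 ?q"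
    by (simp only: simple_distributed_sum_space[OF XY_dist] mult_1)
  finally show ?thesis .
qed

section \<open>Absolute symbol secrecy of the syndrome code\<close>

theorem proposition6:
  fixes M :: "'w measure"
    and X :: "nat \<Rightarrow> 'w \<Rightarrow> 'a::{finite, field}"
    and H :: "'a mat"
    and C :: "'a vec set"
    and enc :: "'a vec \<Rightarrow> bool list"
    and n k d :: nat
    and L :: real
  assumes "prob_space M"
    and "uniform_iid M n X"
    and "1 \<le> k" and "k \<le> n"
    and "mds_code n k d C"
    and "H \<in> carrier_mat (n - k) n"
    and "parity_check_matrix H C"
    and "inj_on enc (carrier_vec (n - k))"
    and "L = real k / real n"
  shows "list_source_code n L (syndrome_encoder H enc) (syndrome_decoder H enc) \<and>
    absolute_symbol_secrecy M n X (\<lambda>\<omega>. syndrome_encoder H enc (source_vec n X \<omega>)) = L"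
proof
  have "n > 0"
    using assms by simp
  have "card C = CARD('a) ^ k"
    using assms(5) by (auto simp: mds_code_def intro: card_linear_code)
  then show "list_source_code n L (syndrome_encoder H enc) (syndrome_decoder H enc)"
    unfolding \<open>L = real k / real n\<close>
    using list_source_code_syndrome[OF assms(6,7) _ \<open>n > 0\<close> assms(8)] by simp
  \<comment> \<open>A field has at least the two elements 0 and 1, so the factor
    \<open>log 2 (real CARD('a))\<close> is strictly positive; the upper bound on \<open>t\<close>
    rests on this.\<close>
  have "card {0, 1 :: 'a} \<le> CARD('a)"
    by (intro card_mono) auto
  then have log_pos: "log 2 (real CARD('a)) > 0"
    by simp
  let ?I = "\<lambda>J. information_space.mutual_information_Pow M 2 (subvector J X)
    (\<lambda>\<omega>. syndrome_encoder H enc (source_vec n X \<omega>))"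
  have I: "?I J = real (card J - k) * log 2 (real CARD('a))"
    if "J \<subseteq> {..<n}" "k \<le> card J" for J
    using mutual_information_subvector_syndrome[OF assms(1,2,6,7,5,8) that] .
  show "absolute_symbol_secrecy M n X (\<lambda>\<omega>. syndrome_encoder H enc (source_vec n X \<omega>)) = L"
    unfolding absolute_symbol_secrecy_def \<open>L = real k / real n\<close>
  proof (rule Max_eqI)
    show "finite {real t / real n |t. t \<le> n \<and> (\<forall>J. J \<subseteq> {..<n} \<and> card J = t \<longrightarrow> ?I J = 0)}"
      by (rule finite_subset[of _ "(\<lambda>t. real t / real n) ` {..n}"]) auto
    \<comment> \<open>At \<open>card J = k\<close> the factor \<open>real (card J - k)\<close> is
      zero.\<close>
    show "real k / real n \<in> {real t / real n |t. t \<le> n \<and> (\<forall>J. J \<subseteq> {..<n} \<and> card J = t \<longrightarrow> ?I J = 0)}"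
      using \<open>k \<le> n\<close> I by auto
    fix r assume "r \<in> {real t / real n |t. t \<le> n \<and> (\<forall>J. J \<subseteq> {..<n} \<and> card J = t \<longrightarrow> ?I J = 0)}"
    then obtain t where r: "r = real t / real n" and t: "t \<le> n"
      and I0: "\<And>J. J \<subseteq> {..<n} \<Longrightarrow> card J = t \<Longrightarrow> ?I J = 0"
      by blast
    \<comment> \<open>For \<open>t > k\<close> a single coordinate set with positive information
      rules out \<open>t\<close>; the initial segment \<open>{..<t}\<close> is such a set.\<close>
    have "t \<le> k"
    proof (rule ccontr)
      assume "\<not> t \<le> k"
      then have "real (t - k) * log 2 (real CARD('a)) = 0"
        using I[of "{..<t}"] I0[of "{..<t}"] t by simp
      then show False
        using \<open>\<not> t \<le> k\<close> log_pos by simp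
    qed
    then show "r \<le> real k / real n"
      using \<open>n > 0\<close> by (simp add: r divide_right_mono)
  qed
qed

end
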